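(* Let $L$ be a modular, l.f.f.c. lattice, and let $L'$ be the sum of the modular connected system which is the dissection of $L$. Then $L'$ is isomorphic to $L$.
   Context: A lattice is l.f.f.c. if every closed interval is finite and every element has finitely many upper and finitely many lower covers. For a tolerance $\gamma$ (reflexive, symmetric relation compatible with $\vee$ and $\wedge$) write $x\le_\gamma y$ for ($x\le y$ and $x\,\gamma\,y$). Dissection: for $x\in L$, $x^*=x$ if $x$ is the top of $L$, else $x^*$ is the join of all upper covers of $x$; dually $x_*$. A block of $L$ is a maximal (under inclusion) complemented interval $B=[0_B,1_B]$ of $L$. The set $S$ of blocks, ordered by $B\le C$ iff $0_B\le 0_C$ (equivalently $1_B\le1_C$), is a lattice. The dissection of $L$ consists of skeleton $S$, tolerance $B\,\gamma\,C$ iff $B\cap C\ne\emptyset$, block $L_B=B$ for each $B\in S$ (ordered as in $L$), and for $B\le C$ with $B\cap C\neq\emptyset$ the connection $\varphi_B^C$, the identity map from $F_B^C=B\cap C$ to $I_B^C=B\cap C$; this is a modular connected system. Sum of a system $(S,\gamma,(L_x)_{x\in S},(\varphi_x^y:F_x^y\to I_x^y)_{x\le_\gamma y})$: $M=\{(x,a):x\in S,a\in L_x\}$ with $(x,a)\sim(y,b)$ iff $x\,\gamma\,y$, $a\in F_x^{x\vee y}$, $b\in F_y^{x\vee y}$ and $\varphi_x^{x\vee y}(a)=\varphi_y^{x\vee y}(b)$ (an equivalence relation); the sum is $M/{\sim}$. With $\pi_x(a)$ the class of $(x,a)$ and $\Lambda_x=\pi_x(L_x)$, write $a\le_v b$ iff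 $a,b\in\Lambda_v$ and $\pi_v^{-1}a\le\pi_v^{-1}b$ in $L_v$; the sum is ordered by $a\le b$ iff there exist $n\ge0$, $x_1\le\dots\le x_n$ in $S$ and $a=a_0\le_{x_1}a_1\le_{x_2}\cdots\le_{x_n}a_n=b$. *)

theory Defs
  imports Main
begin

unbundle lattice_syntax

text \<open>
  A system over a skeleton of indices: the summands are the sets \<open>blk x\<close> ordered by
  \<open>blk_le x\<close>, and \<open>conn x y\<close> maps the filter \<open>conn_dom x y\<close> of \<open>blk x\<close> to the ideal
  \<open>conn_cod x y\<close> of \<open>blk y\<close>. The three \<open>conn\<close> components are meaningful only for
  \<open>x \<le> y\<close> with \<open>tol x y\<close>.
\<close>

record ('i, 'a) system =
  skel :: "'i set"
  skel_le :: "'i \<Rightarrow> 'i \<Rightarrow> bool"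
  tol :: "'i \<Rightarrow> 'i \<Rightarrow> bool"
  blk :: "'i \<Rightarrow> 'a set"
  blk_le :: "'i \<Rightarrow> 'a \<Rightarrow> 'a \<Rightarrow> bool"
  conn_dom :: "'i \<Rightarrow> 'i \<Rightarrow> 'a set"
  conn_cod :: "'i \<Rightarrow> 'i \<Rightarrow> 'a set"
  conn :: "'i \<Rightarrow> 'i \<Rightarrow> 'a \<Rightarrow> 'a"

definition skel_join :: "('i, 'a) system \<Rightarrow> 'i \<Rightarrow> 'i \<Rightarrow> 'i" where
  "skel_join \<S> x y = (THE z. z \<in> skel \<S> \<and> skel_le \<S> x z \<and> skel_le \<S> y z \<and>
     (\<forall>w \<in> skel \<S>. skel_le \<S> x w \<and> skel_le \<S> y w \<longrightarrow> skel_le \<S> z w))"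

definition sum_rel :: "('i, 'a) system \<Rightarrow> (('i \<times> 'a) \<times> ('i \<times> 'a)) set" where
  "sum_rel \<S> = {((x, a), (y, b)).
     (x, a) \<in> Sigma (skel \<S>) (blk \<S>) \<and> (y, b) \<in> Sigma (skel \<S>) (blk \<S>) \<and>
     tol \<S> x y \<and>
     a \<in> conn_dom \<S> x (skel_join \<S> x y) \<and> b \<in> conn_dom \<S> y (skel_join \<S> x y) \<and>
     conn \<S> x (skel_join \<S> x y) a = conn \<S> y (skel_join \<S> x y) b}"

definition sum_carrier :: "('i, 'a) system \<Rightarrow> ('i \<times> 'a) set set" where
  "sum_carrier \<S> = Sigma (skel \<S>) (blk \<S>) // sum_rel \<S>"

definition sum_proj :: "('i, 'a) system \<Rightarrow> 'i \<Rightarrow> 'a \<Rightarrow> ('i \<times> 'a) set" where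
  "sum_proj \<S> x a = sum_rel \<S> `` {(x, a)}"

text \<open>
  The relation \<open>\<le>\<^sub>v\<close> on the image of \<open>blk v\<close> in the sum; \<open>p\<close> and \<open>q\<close> below are the
  preimages of \<open>a\<close> and \<open>b\<close> under the projection.
\<close>

definition sum_le_at :: "('i, 'a) system \<Rightarrow> 'i \<Rightarrow> ('i \<times> 'a) set \<Rightarrow> ('i \<times> 'a) set \<Rightarrow> bool" where
  "sum_le_at \<S> v a b \<longleftrightarrow>
     (\<exists>p \<in> blk \<S> v. \<exists>q \<in> blk \<S> v. a = sum_proj \<S> v p \<and> b = sum_proj \<S> v q \<and> blk_le \<S> v p q)"

text \<open>The indices \<open>x\<^sub>1, \<dots>, x\<^sub>n\<close> of the chain are numbered \<open>x 0, \<dots>, x (n - 1)\<close> here.\<close>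

definition sum_le :: "('i, 'a) system \<Rightarrow> ('i \<times> 'a) set \<Rightarrow> ('i \<times> 'a) set \<Rightarrow> bool" where
  "sum_le \<S> a b \<longleftrightarrow>
     (\<exists>(n::nat) x c. c 0 = a \<and> c n = b \<and>
        (\<forall>i<n. x i \<in> skel \<S> \<and> sum_le_at \<S> (x i) (c i) (c (Suc i))) \<and>
        (\<forall>i. Suc i < n \<longrightarrow> skel_le \<S> (x i) (x (Suc i))))"

definition covers :: "'a::order \<Rightarrow> 'a \<Rightarrow> bool" where
  "covers b a \<longleftrightarrow> a < b \<and> \<not> (\<exists>c. a < c \<and> c < b)"

definition complemented_interval :: "'a::lattice set \<Rightarrow> bool" where
  "complemented_interval B \<longleftrightarrow>
     (\<exists>u v. u \<le> v \<and> B = {u..v} \<and> (\<forall>x \<in> B. \<exists>y \<in> B. x \<sqinter> y = u \<and> x \<squnion> y = v))"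

definition block :: "'a::lattice set \<Rightarrow> bool" where
  "block B \<longleftrightarrow> complemented_interval B \<and>
     (\<forall>C. complemented_interval C \<and> B \<subseteq> C \<longrightarrow> C = B)"

definition dissection :: "('a::lattice set, 'a) system" where
  "dissection = \<lparr>
     skel = {B. block B},
     skel_le = (\<lambda>B C. (LEAST a. a \<in> B) \<le> (LEAST a. a \<in> C)),
     tol = (\<lambda>B C. B \<inter> C \<noteq> {}),
     blk = (\<lambda>B. B),
     blk_le = (\<lambda>B. (\<le>)),
     conn_dom = (\<lambda>B C. B \<inter> C),
     conn_cod = (\<lambda>B C. B \<inter> C),
     conn = (\<lambda>B C a. a)\<rparr>"

definition order_isomorphic ::
    "'a set \<Rightarrow> ('a \<Rightarrow> 'a \<Rightarrow> bool) \<Rightarrow> 'b set \<Rightarrow> ('b \<Rightarrow> 'b \<Rightarrow> bool) \<Rightarrow> bool" where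
  "order_isomorphic A leA B leB \<longleftrightarrow>
     (\<exists>f. bij_betw f A B \<and> (\<forall>x \<in> A. \<forall>y \<in> A. leA x y \<longleftrightarrow> leB (f x) (f y)))"

end

(*
  In a modular l.f.f.c. lattice, let up x be the join of x and its upper covers and down x the meet
  of x and its lower covers. Both maps are monotone, the interval [x, up x] is complemented, and
  every complemented interval [u, v] satisfies v <= up u and down v <= u. Hence down is left adjoint
  to up, and the blocks are the intervals [u, up u] with u in the image of down. This image is
  closed under joins, so the bottom of the join of two blocks is the join of their bottoms, and
  therefore (B, a) ~ (C, b) holds exactly if a = b. For the order, a maximal chain from a to b
  passes through the blocks with bottoms down c_i, one for each covering step from c_(i-1) to c_i.
*)

theory Submission
  imports Defs
begin

section \<open>Joins of upper covers and meets of lower covers\<close>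

text \<open>The order is a parameter here, so that every result can be reused for the dual order.
  Hence intervals and covers are spelled out in \<open>\<le>\<close> and \<open><\<close>: the
  constants \<open>{a..b}\<close> and \<open>covers\<close> are tied to the order of the
  type.\<close>

class modular_lffc = lattice +
  assumes modular_law: "a \<le> c \<Longrightarrow> a \<squnion> (b \<sqinter> c) = (a \<squnion> b) \<sqinter> c"
    and finite_between: "finite {c. a \<le> c \<and> c \<le> b}"
    and finite_upper: "finite {b. a < b \<and> \<not> (\<exists>c. a < c \<and> c < b)}"
    and finite_lower: "finite {b. b < a \<and> \<not> (\<exists>c. b < c \<and> c < a)}"
begin

lemma dual_modular_lffc: "class.modular_lffc sup (\<ge>) (>) inf"
proof -
  interpret dual: lattice sup "(\<ge>)" "(>)" inf by (rule dual_lattice)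
  show ?thesis
  proof
    fix a b c
    show "c \<le> a \<Longrightarrow> a \<sqinter> (b \<squnion> c) = (a \<sqinter> b) \<squnion> c"
      using modular_law[of c a b] by (simp add: ac_simps)
    show "finite {c. c \<le> a \<and> b \<le> c}"
      using finite_between[of b a] by (simp add: conj_commute)
    show "finite {b. b < a \<and> \<not> (\<exists>c. c < a \<and> b < c)}"
      using finite_lower[of a] by (simp add: conj_commute)
    show "finite {b. a < b \<and> \<not> (\<exists>c. c < b \<and> a < c)}"
      using finite_upper[of a] by (simp add: conj_commute)
  qed
qed

text \<open>This is x^* of the dissection. \<open>insert x\<close> keeps the finite join defined
  when \<open>x\<close> has no upper cover, and then \<open>up x = x\<close>.\<close>

definition up :: "'a \<Rightarrow> 'a" where
  "up x = \<Squnion>\<^sub>f\<^sub>i\<^sub>n (insert x {b. x < b \<and> \<not> (\<exists>c. x < c \<and> c < b)})"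

definition down :: "'a \<Rightarrow> 'a" where
  "down x = \<Sqinter>\<^sub>f\<^sub>i\<^sub>n (insert x {b. b < x \<and> \<not> (\<exists>c. b < c \<and> c < x)})"

text \<open>The bounds are arguments instead of a set, so that dualizing merely swaps them.\<close>

definition complemented :: "'a \<Rightarrow> 'a \<Rightarrow> bool" where
  "complemented u v \<longleftrightarrow> u \<le> v \<and>
     (\<forall>x. u \<le> x \<and> x \<le> v \<longrightarrow> (\<exists>y. u \<le> y \<and> y \<le> v \<and> x \<sqinter> y = u \<and> x \<squnion> y = v))"

lemma dual_up: "modular_lffc.up (>) inf = down"
proof -
  interpret dual: modular_lffc sup "(\<ge>)" "(>)" inf by (rule dual_modular_lffc)
  show ?thesis
    by (rule ext) (simp add: dual.up_def down_def dual.Sup_fin_def Inf_fin_def conj_commute)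
qed

lemma dual_complemented: "modular_lffc.complemented sup (\<ge>) inf v u = complemented u v"
proof -
  interpret dual: modular_lffc sup "(\<ge>)" "(>)" inf by (rule dual_modular_lffc)
  show ?thesis
    unfolding dual.complemented_def complemented_def by blast
qed

section \<open>The join of the upper covers in a modular lattice\<close>

lemma up_ge: "x \<le> up x"
  unfolding up_def by (rule Sup_fin.coboundedI) (use finite_upper[of x] in auto)

lemma cover_le_up: "x < b \<Longrightarrow> \<not> (\<exists>c. x < c \<and> c < b) \<Longrightarrow> b \<le> up x"
  unfolding up_def by (rule Sup_fin.coboundedI) (use finite_upper[of x] in auto)

lemma up_leI:
  assumes "x \<le> y" "\<And>b. x < b \<Longrightarrow> \<not> (\<exists>c. x < c \<and> c < b) \<Longrightarrow> b \<le> y"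
  shows "up x \<le> y"
  unfolding up_def by (rule Sup_fin.boundedI) (use assms finite_upper[of x] in auto)

lemma ex_cover_below:
  assumes "u < y"
  shows "\<exists>a. u < a \<and> \<not> (\<exists>c. u < c \<and> c < a) \<and> a \<le> y"
proof -
  let ?A = "{c. u \<le> c \<and> c \<le> y} - {u}"
  have "finite ?A" "y \<in> ?A"
    using finite_between[of u y] assms by auto
  then obtain a where "a \<in> ?A" and min: "\<And>b. b \<in> ?A \<Longrightarrow> b \<le> a \<Longrightarrow> a = b"
    using finite_has_minimal[of ?A] by blast
  then have "u < a" "a \<le> y" by (auto simp: less_le)
  moreover have "\<not> (\<exists>c. u < c \<and> c < a)"
    using min \<open>a \<le> y\<close> by (force simp: less_le)
  ultimately show ?thesis by blast
qed

text \<open>The covers of \<open>x\<close> are the atoms of this interval. For a maximal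
  \<open>y\<close> with \<open>w \<sqinter> y = x\<close>, every atom \<open>a\<close> lies below
  \<open>w \<squnion> y\<close>: otherwise modularity yields
  \<open>w \<sqinter> (y \<squnion> a) = x\<close>, against maximality.\<close>

lemma complemented_up: "complemented x (up x)"
  unfolding complemented_def
proof (intro conjI allI impI)
  show "x \<le> up x" by (rule up_ge)
  fix w assume w: "x \<le> w \<and> w \<le> up x"
  let ?A = "{y. x \<le> y \<and> y \<le> up x} \<inter> {y. w \<sqinter> y = x}"
  have "x \<in> ?A" using w by (auto simp: up_ge inf.absorb2)
  moreover have "finite ?A" using finite_between by auto
  ultimately obtain y where y: "y \<in> ?A" and max: "\<And>z. z \<in> ?A \<Longrightarrow> y \<le> z \<Longrightarrow> y = z"
    using finite_has_maximal[of ?A] by blast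
  have "up x \<le> w \<squnion> y"
  proof (rule up_leI)
    show "x \<le> w \<squnion> y" using w by (simp add: le_supI1)
    fix a assume a: "x < a" "\<not> (\<exists>c. x < c \<and> c < a)"
    show "a \<le> w \<squnion> y"
    proof (rule ccontr)
      assume na: "\<not> a \<le> w \<squnion> y"
      have "x \<le> a \<sqinter> (w \<squnion> y)" using a w by (simp add: le_supI1)
      moreover have "a \<sqinter> (w \<squnion> y) < a" using na by (simp add: less_le inf.absorb_iff1[of a "w \<squnion> y"])
      ultimately have "a \<sqinter> (w \<squnion> y) = x" using a(2) by (metis less_le)
      \<comment> \<open>The modular law applies because \<open>y \<le> w \<squnion> y\<close>; its
        other side is \<open>y \<squnion> (a \<sqinter> (w \<squnion> y)) = y \<squnion> x =
        y\<close>.\<close>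
      then have eq: "(y \<squnion> a) \<sqinter> (w \<squnion> y) = y"
        using modular_law[of y "w \<squnion> y" a] y by (simp add: sup.absorb1)
      have "w \<sqinter> (y \<squnion> a) = w \<sqinter> ((y \<squnion> a) \<sqinter> (w \<squnion> y))"
        by (metis inf.commute inf.left_commute inf_sup_absorb)
      then have "w \<sqinter> (y \<squnion> a) = x" using eq y by simp
      moreover have "x \<le> y \<squnion> a" "y \<squnion> a \<le> up x"
        using y cover_le_up[OF a] by (auto intro: le_supI1)
      ultimately have "y = y \<squnion> a" using max[of "y \<squnion> a"] by simp
      then have "a \<le> y" by (metis sup.cobounded2)
      then show False using na by (simp add: le_supI2)
    qed
  qed
  then have "w \<squnion> y = up x" using w y by (auto intro: order.antisym)
  then show "\<exists>y. x \<le> y \<and> y \<le> up x \<and> w \<sqinter> y = x \<and> w \<squnion> y = up x"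
    using y by auto
qed

text \<open>A complement \<open>y\<close> of \<open>v \<sqinter> up u\<close> must be
  \<open>u\<close>: otherwise some cover of \<open>u\<close> lies below \<open>y\<close>, and it
  lies below \<open>v \<sqinter> up u\<close> as well. Hence
  \<open>v \<sqinter> up u = v\<close>.\<close>

lemma complemented_le_up:
  assumes "complemented u v"
  shows "v \<le> up u"
proof -
  have "u \<le> v" using assms by (simp add: complemented_def)
  then have "u \<le> v \<sqinter> up u" "v \<sqinter> up u \<le> v" by (auto simp: up_ge)
  then obtain y where y: "u \<le> y" "y \<le> v" "(v \<sqinter> up u) \<sqinter> y = u" "(v \<sqinter> up u) \<squnion> y = v"
    using assms unfolding complemented_def by blast
  have "y = u"
  proof (rule ccontr)
    assume "y \<noteq> u"
    then have "u < y" using y by simp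
    then obtain a where a: "u < a" "\<not> (\<exists>c. u < c \<and> c < a)" "a \<le> y"
      using ex_cover_below by blast
    have "a \<le> (v \<sqinter> up u) \<sqinter> y"
      using cover_le_up[OF a(1,2)] a(3) y(2) by (auto intro: order.trans)
    then show False using y(3) a(1) by simp
  qed
  then show ?thesis
    using y(4) \<open>u \<le> v \<sqinter> up u\<close> by (metis inf.cobounded2 sup.absorb1)
qed

text \<open>A cover \<open>a\<close> of \<open>x\<close> is pushed up to
  \<open>y \<squnion> a\<close>, which is \<open>y\<close> itself or, by modularity, a cover of
  \<open>y\<close>.\<close>

lemma up_mono:
  assumes "x \<le> y"
  shows "up x \<le> up y"
proof (rule up_leI)
  show "x \<le> up y" using assms up_ge order.trans by blast
  fix a assume a: "x < a" "\<not> (\<exists>c. x < c \<and> c < a)"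
  show "a \<le> up y"
  proof (cases "a \<le> y")
    case True
    then show ?thesis using up_ge order.trans by blast
  next
    case False
    have "y < y \<squnion> a" using False by (metis less_le sup.cobounded1 sup.cobounded2)
    moreover have "\<not> (\<exists>c. y < c \<and> c < y \<squnion> a)"
    proof
      assume "\<exists>c. y < c \<and> c < y \<squnion> a"
      then obtain c where c: "y < c" "c < y \<squnion> a" by blast
      have "x \<le> a \<sqinter> c" using assms a c by (simp add: less_le) (metis order.trans)
      moreover have "a \<sqinter> c \<noteq> a"
        using c by (metis inf.cobounded2 leD le_supI less_imp_le)
      ultimately have "a \<sqinter> c = x" using a(2) by (metis inf.cobounded1 less_le)
      \<comment> \<open>By modularity \<open>c = (y \<squnion> a) \<sqinter> c = y \<squnion> (a
        \<sqinter> c) = y \<squnion> x = y\<close>.\<close>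
      then have "c = y"
        using modular_law[of y c a] c assms by (simp add: inf.absorb2 sup.absorb1 less_imp_le)
      then show False using c by simp
    qed
    ultimately have "y \<squnion> a \<le> up y" by (rule cover_le_up)
    then show ?thesis by simp
  qed
qed

section \<open>The dual map and the adjunction\<close>

lemma down_le: "down x \<le> x"
  using modular_lffc.up_ge[OF dual_modular_lffc] by (simp add: dual_up)

lemma down_le_cover: "b < x \<Longrightarrow> \<not> (\<exists>c. b < c \<and> c < x) \<Longrightarrow> down x \<le> b"
  using modular_lffc.cover_le_up[OF dual_modular_lffc, of b x] by (auto simp: dual_up)

lemma complemented_down: "complemented (down x) x"
  using modular_lffc.complemented_up[OF dual_modular_lffc]
  by (simp add: dual_up dual_complemented)

lemma complemented_down_le: "complemented u v \<Longrightarrow> down v \<le> u"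
  using modular_lffc.complemented_le_up[OF dual_modular_lffc]
  by (simp add: dual_up dual_complemented)

lemma down_mono: "x \<le> y \<Longrightarrow> down x \<le> down y"
  using modular_lffc.up_mono[OF dual_modular_lffc] by (simp add: dual_up)

text \<open>The counit of the adjunction; \<open>le_up_down\<close> is its unit.\<close>

lemma down_up_le: "down (up x) \<le> x"
  by (rule complemented_down_le[OF complemented_up])

lemma le_up_down: "x \<le> up (down x)"
  by (rule complemented_le_up[OF complemented_down])

lemma down_up_down: "down (up (down x)) = down x"
  by (rule order.antisym[OF down_up_le down_mono[OF le_up_down]])

text \<open>The equation \<open>down (up u) = u\<close> singles out the image of
  \<open>down\<close>, and the image of a left adjoint is closed under joins. This provides the
  block that starts at the join of two bottoms.\<close>

lemma down_up_sup:
  assumes "down (up u) = u" "down (up v) = v"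
  shows "down (up (u \<squnion> v)) = u \<squnion> v"
proof (rule order.antisym[OF down_up_le])
  have "down (up u) \<le> down (up (u \<squnion> v))" "down (up v) \<le> down (up (u \<squnion> v))"
    by (auto intro!: down_mono up_mono)
  then show "u \<squnion> v \<le> down (up (u \<squnion> v))" using assms by simp
qed

end

section \<open>The dissection and its sum\<close>

lemma Least_atLeastAtMost: "u \<le> v \<Longrightarrow> (LEAST a. a \<in> {u..v}) = (u :: 'a :: order)"
  by (rule Least_equality) auto

text \<open>The type in the theorem only has sort \<open>lattice\<close>, so the class enters as a
  predicate and is interpreted; this makes \<open>up\<close> and \<open>down\<close> available on
  that type.\<close>

context
  assumes M: "class.modular_lffc (inf :: 'a::lattice \<Rightarrow> 'a \<Rightarrow> 'a) (\<le>) (<) sup"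
begin

interpretation modular_lffc "inf :: 'a \<Rightarrow> 'a \<Rightarrow> 'a" "(\<le>)" "(<)" sup
  by (rule M)

section \<open>Blocks and their joins\<close>

lemma complemented_interval_iff:
  "complemented_interval B \<longleftrightarrow> (\<exists>u v. B = {u..v} \<and> complemented u v)"
  unfolding complemented_interval_def complemented_def by (fastforce simp: Bex_def)

text \<open>A maximal \<open>{u..v}\<close> equals both of its complemented extensions
  \<open>{u..up u}\<close> and \<open>{down v..v}\<close>. Conversely, a complemented
  \<open>{s..t}\<close> around \<open>{u..up u}\<close> satisfies
  \<open>t \<le> up s \<le> up u\<close> and
  \<open>u = down (up u) \<le> down t \<le> s\<close>.\<close>

lemma block_iff: "block B \<longleftrightarrow> (\<exists>u. down (up u) = u \<and> B = {u..up u})"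
proof
  assume B: "block B"
  then obtain u v where uv: "B = {u..v}" "complemented u v"
    by (auto simp: block_def complemented_interval_iff)
  have "u \<le> v" using uv(2) by (simp add: complemented_def)
  have max: "{u'..v'} = {u..v}" if "complemented u' v'" "u' \<le> u" "v \<le> v'" for u' v'
  proof -
    have "{u..v} \<subseteq> {u'..v'}" using that by auto
    then show ?thesis
      using B that(1) unfolding block_def complemented_interval_iff uv(1) by blast
  qed
  have "v = up u"
    using max[OF complemented_up order.refl complemented_le_up[OF uv(2)]] \<open>u \<le> v\<close>
    by (simp add: Icc_eq_Icc up_ge)
  moreover have "down v = u"
    using max[OF complemented_down complemented_down_le[OF uv(2)] order.refl] \<open>u \<le> v\<close>
    by (simp add: Icc_eq_Icc down_le)
  ultimately show "\<exists>u. down (up u) = u \<and> B = {u..up u}" using uv(1) by auto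
next
  assume "\<exists>u. down (up u) = u \<and> B = {u..up u}"
  then obtain u where u: "down (up u) = u" "B = {u..up u}" by blast
  have "C = B" if C: "complemented_interval C" "B \<subseteq> C" for C
  proof -
    obtain s t where st: "C = {s..t}" "complemented s t"
      using C(1) by (auto simp: complemented_interval_iff)
    have "s \<le> u" "up u \<le> t" using C(2) u(2) st(1) up_ge by auto
    moreover have "t \<le> up u"
      using complemented_le_up[OF st(2)] up_mono[OF \<open>s \<le> u\<close>] by (rule order.trans)
    moreover have "u \<le> s"
      using complemented_down_le[OF st(2)] down_mono[OF \<open>up u \<le> t\<close>] u(1) by simp
    ultimately show ?thesis using u(2) st(1) by auto
  qed
  then show "block B"
    unfolding block_def complemented_interval_iff using u(2) complemented_up by blast
qed

text \<open>With \<open>block_down_mem\<close> this gives every element a canonical block around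
  it.\<close>

lemma block_down: "block {down a..up (down a)}"
  unfolding block_iff using down_up_down by blast

lemma block_down_mem: "c \<in> {down c..up (down c)}"
  by (simp add: down_le le_up_down)

text \<open>\<open>skel_le\<close> compares bottoms only, and a bottom determines its block through
  \<open>up\<close>; so it suffices that \<open>u \<squnion> v\<close> is again the bottom of a
  block.\<close>

lemma skel_join_dissection:
  assumes u: "down (up u) = u" and v: "down (up v) = v"
  shows "skel_join dissection {u..up u} {v..up v} = {u \<squnion> v..up (u \<squnion> v)}"
proof -
  have least: "(LEAST a. a \<in> {w..up w}) = w" for w
    by (simp add: Least_atLeastAtMost up_ge del: atLeastAtMost_iff)
  have blk: "block {u \<squnion> v..up (u \<squnion> v)}"
    unfolding block_iff using down_up_sup[OF u v] by blast
  show ?thesis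
    unfolding skel_join_def
  proof (rule the_equality)
    show "{u \<squnion> v..up (u \<squnion> v)} \<in> skel dissection \<and>
      skel_le dissection {u..up u} {u \<squnion> v..up (u \<squnion> v)} \<and>
      skel_le dissection {v..up v} {u \<squnion> v..up (u \<squnion> v)} \<and>
      (\<forall>w\<in>skel dissection. skel_le dissection {u..up u} w \<and> skel_le dissection {v..up v} w
         \<longrightarrow> skel_le dissection {u \<squnion> v..up (u \<squnion> v)} w)"
      using blk by (simp add: dissection_def least del: atLeastAtMost_iff)
  next
    fix D
    assume D: "D \<in> skel dissection \<and>
      skel_le dissection {u..up u} D \<and> skel_le dissection {v..up v} D \<and>
      (\<forall>w\<in>skel dissection. skel_le dissection {u..up u} w \<and> skel_le dissection {v..up v} w
         \<longrightarrow> skel_le dissection D w)"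
    then obtain d where d: "D = {d..up d}" by (auto simp: dissection_def block_iff)
    have "u \<squnion> v \<le> d"
      using D by (simp add: dissection_def least d del: atLeastAtMost_iff)
    moreover have "d \<le> u \<squnion> v"
      using D blk by (auto simp add: dissection_def least d simp del: atLeastAtMost_iff)
    ultimately have "d = u \<squnion> v" by (rule antisym[rotated])
    then show "D = {u \<squnion> v..up (u \<squnion> v)}" using d by simp
  qed
qed

section \<open>The carrier of the sum\<close>

lemma sum_rel_dissection:
  "sum_rel dissection = {((B, a), (C, b)). block B \<and> block C \<and> a = b \<and> a \<in> B \<and> (a::'a) \<in> C}"
proof -
  \<comment> \<open>The connections are identities, so it remains to see that a common element of
    two blocks lies in their join: it is above both bottoms and below
    \<open>up u \<le> up (u \<squnion> v)\<close>.\<close>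
  have "a \<in> skel_join dissection B C" if BC: "block B" "block C" "a \<in> B" "a \<in> C" for B C and a :: 'a
  proof -
    obtain u where u: "down (up u) = u" "B = {u..up u}"
      using BC(1) unfolding block_iff by blast
    obtain v where v: "down (up v) = v" "C = {v..up v}"
      using BC(2) unfolding block_iff by blast
    have "a \<le> up (u \<squnion> v)"
      using BC(3) u(2) up_mono[of u "u \<squnion> v"] by auto
    then show ?thesis
      using BC(3,4) u v by (simp add: skel_join_dissection)
  qed
  then show ?thesis
    unfolding sum_rel_def by (auto simp: dissection_def)
qed

lemma sum_proj_dissection:
  "block B \<Longrightarrow> a \<in> B \<Longrightarrow> sum_proj dissection B a = {B. block B \<and> a \<in> B} \<times> {a :: 'a}"
  unfolding sum_proj_def sum_rel_dissection by auto

lemma bij_betw_sum_carrier_dissection: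
  "bij_betw (\<lambda>a :: 'a. {B. block B \<and> a \<in> B} \<times> {a}) UNIV (sum_carrier dissection)"
proof (rule bij_betw_imageI)
  show "inj (\<lambda>a :: 'a. {B. block B \<and> a \<in> B} \<times> {a})"
  proof (rule injI)
    fix a b :: 'a
    assume eq: "{B. block B \<and> a \<in> B} \<times> {a} = {B. block B \<and> b \<in> B} \<times> {b}"
    \<comment> \<open>The class of \<open>a\<close> is nonempty, so \<open>a\<close> can be read off
      from second components.\<close>
    have "({down a..up (down a)}, a) \<in> {B. block B \<and> a \<in> B} \<times> {a}"
      using block_down block_down_mem by blast
    then show "a = b" unfolding eq by blast
  qed
  have "sum_carrier dissection =
      (\<lambda>(B, a). sum_proj dissection B a) ` {(B, a :: 'a). block B \<and> a \<in> B}"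
    by (auto simp: sum_carrier_def quotient_def sum_proj_def dissection_def)
  also have "\<dots> = (\<lambda>(B, a :: 'a). {B. block B \<and> a \<in> B} \<times> {a}) ` {(B, a). block B \<and> a \<in> B}"
    by (rule image_cong) (auto simp: sum_proj_dissection)
  also have "\<dots> = range (\<lambda>a. {B. block B \<and> a \<in> B} \<times> {a})"
    using block_down block_down_mem by (fastforce simp: image_iff)
  finally show "range (\<lambda>a. {B. block B \<and> a \<in> B} \<times> {a :: 'a}) = sum_carrier dissection" ..
qed

section \<open>The order of the sum\<close>

lemma sum_le_at_dissection:
  assumes "block B"
  shows "sum_le_at dissection B X Y \<longleftrightarrow> (\<exists>a \<in> B. \<exists>b \<in> B. (a :: 'a) \<le> b \<and>
           X = {B. block B \<and> a \<in> B} \<times> {a} \<and> Y = {B. block B \<and> b \<in> B} \<times> {b})"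
proof -
  have "sum_le_at dissection B X Y \<longleftrightarrow> (\<exists>a \<in> B. \<exists>b \<in> B. (a :: 'a) \<le> b \<and>
           X = sum_proj dissection B a \<and> Y = sum_proj dissection B b)"
    unfolding sum_le_at_def by (auto simp: dissection_def)
  then show ?thesis by (simp add: sum_proj_dissection[OF assms] cong: bex_cong)
qed

text \<open>Along the chain every \<open>c i\<close> is the class of an element above
  \<open>a\<close>; injectivity of \<open>?g\<close> identifies the representatives of
  \<open>c i\<close> that come from adjacent steps.\<close>

lemma sum_le_dissection_imp_le:
  assumes "sum_le dissection ({B. block B \<and> a \<in> B} \<times> {a}) ({B. block B \<and> b \<in> B} \<times> {b})"
  shows "(a :: 'a) \<le> b"
proof -
  let ?g = "\<lambda>a :: 'a. {B. block B \<and> a \<in> B} \<times> {a}"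
  have inj: "?g p = ?g q \<longleftrightarrow> p = q" for p q
    using bij_betw_sum_carrier_dissection unfolding bij_betw_def by (rule inj_eq[OF conjunct1])
  obtain n :: nat and x c where c: "c 0 = ?g a" "c n = ?g b"
    and step: "\<And>i. i < n \<Longrightarrow> x i \<in> skel dissection \<and> sum_le_at dissection (x i) (c i) (c (Suc i))"
    using assms unfolding sum_le_def by blast
  have "\<exists>d. c i = ?g d \<and> a \<le> d" if "i \<le> n" for i
    using that
  proof (induction i)
    case 0
    then show ?case using c(1) by blast
  next
    case (Suc i)
    then obtain d where d: "c i = ?g d" "a \<le> d" by auto
    have "block (x i)" "sum_le_at dissection (x i) (c i) (c (Suc i))"
      using step[of i] Suc.prems by (auto simp: dissection_def)
    then obtain p q where pq: "p \<le> q" "c i = ?g p" "c (Suc i) = ?g q"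
      unfolding sum_le_at_dissection[OF \<open>block (x i)\<close>] by blast
    then have "p = d" using d(1) inj by metis
    then show ?case using pq d(2) by (meson order.trans)
  qed
  from this[of n] show ?thesis using c(2) inj by (metis order.refl)
qed

text \<open>Passing to a cover \<open>a'\<close> of \<open>a\<close> below \<open>b\<close> shrinks
  the finite interval; \<open>case_nat\<close> then prepends \<open>a\<close> to the chain from
  \<open>a'\<close>.\<close>

lemma ex_cover_chain:
  assumes "(a :: 'a) \<le> b"
  shows "\<exists>(n::nat) d. d 0 = a \<and> d n = b \<and> (\<forall>i<n. covers (d (Suc i)) (d i))"
  using assms
proof (induction "card {c. a \<le> c \<and> c \<le> b}" arbitrary: a rule: less_induct)
  case less
  show ?case
  proof (cases "a = b")
    case True
    then show ?thesis by (intro exI[of _ 0] exI[of _ "\<lambda>_. a"]) simp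
  next
    case False
    then have "a < b" using less.prems by simp
    then obtain a' where a': "a < a'" "\<not> (\<exists>c. a < c \<and> c < a')" "a' \<le> b"
      using ex_cover_below by blast
    have "{c. a' \<le> c \<and> c \<le> b} \<subset> {c. a \<le> c \<and> c \<le> b}"
    proof
      show "{c. a' \<le> c \<and> c \<le> b} \<subseteq> {c. a \<le> c \<and> c \<le> b}" using a'(1) by auto
      have "a \<in> {c. a \<le> c \<and> c \<le> b}" "a \<notin> {c. a' \<le> c \<and> c \<le> b}"
        using a'(1) less.prems by auto
      then show "{c. a' \<le> c \<and> c \<le> b} \<noteq> {c. a \<le> c \<and> c \<le> b}" by blast
    qed
    then obtain n d where d: "d 0 = a'" "d n = b" "\<forall>i<n. covers (d (Suc i)) (d i)"
      using less.hyps a'(3) psubset_card_mono[OF finite_between] by meson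
    have "\<forall>i < Suc n. covers (case_nat a d (Suc i)) (case_nat a d i)"
      using d a' by (auto simp: covers_def split: nat.split)
    then show ?thesis
      using d(2) by (intro exI[of _ "Suc n"] exI[of _ "case_nat a d"]) simp
  qed
qed

lemma le_imp_sum_le_dissection:
  assumes "(a :: 'a) \<le> b"
  shows "sum_le dissection ({B. block B \<and> a \<in> B} \<times> {a}) ({B. block B \<and> b \<in> B} \<times> {b})"
proof -
  obtain n :: nat and d where d: "d 0 = a" "d n = b" "\<And>i. i < n \<Longrightarrow> covers (d (Suc i)) (d i)"
    using ex_cover_chain[OF assms] by blast
  \<comment> \<open>The step from \<open>d i\<close> to \<open>d (Suc i)\<close> uses the canonical
    block of its upper end. It contains \<open>d i\<close>, a lower cover of that end, and
    monotonicity of \<open>down\<close> puts the blocks in increasing order.\<close>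
  define x where "x i = {down (d (Suc i))..up (down (d (Suc i)))}" for i
  define c where "c i = {B. block B \<and> d i \<in> B} \<times> {d i}" for i
  have blk: "block (x i)" for i unfolding x_def by (rule block_down)
  have "sum_le_at dissection (x i) (c i) (c (Suc i))" if "i < n" for i
  proof -
    have cov: "d i < d (Suc i)" "\<not> (\<exists>z. d i < z \<and> z < d (Suc i))"
      using d(3)[OF that] by (auto simp: covers_def)
    have "d (Suc i) \<in> x i" unfolding x_def by (rule block_down_mem)
    moreover have "d i \<in> x i"
      using down_le_cover[OF cov] cov(1) le_up_down[of "d (Suc i)"] by (simp add: x_def)
    ultimately show ?thesis
      using cov(1) unfolding sum_le_at_dissection[OF blk] c_def
      by (blast intro: less_imp_le)
  qed
  moreover have "x i \<in> skel dissection" for i using blk by (simp add: dissection_def)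
  moreover have "skel_le dissection (x i) (x (Suc i))" if "Suc i < n" for i
    using d(3)[OF that] down_mono[of "d (Suc i)" "d (Suc (Suc i))"]
    by (simp add: dissection_def x_def Least_atLeastAtMost up_ge covers_def less_imp_le
        del: atLeastAtMost_iff)
  ultimately show ?thesis
    unfolding sum_le_def using d(1,2)
    by (intro exI[of _ n] exI[of _ x] exI[of _ c]) (simp add: c_def)
qed

end

theorem theorem7p5:
  assumes modular: "\<And>a b c :: 'a::lattice. a \<le> c \<Longrightarrow> a \<squnion> (b \<sqinter> c) = (a \<squnion> b) \<sqinter> c"
    and finite_intervals: "\<And>a b :: 'a. finite {a..b}"
    and finite_upper_covers: "\<And>a :: 'a. finite {b. covers b a}"
    and finite_lower_covers: "\<And>a :: 'a. finite {b. covers a b}"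
  shows "order_isomorphic
           (sum_carrier (dissection :: ('a set, 'a) system)) (sum_le dissection)
           (UNIV :: 'a set) (\<le>)"
proof -
  have M: "class.modular_lffc (inf :: 'a \<Rightarrow> 'a \<Rightarrow> 'a) (\<le>) (<) sup"
  proof
    fix a b c :: 'a
    show "a \<le> c \<Longrightarrow> a \<squnion> (b \<sqinter> c) = (a \<squnion> b) \<sqinter> c" by (rule modular)
    show "finite {c. a \<le> c \<and> c \<le> b}"
      using finite_intervals[of a b] by (simp add: atLeastAtMost_def atLeast_def atMost_def Int_def)
    show "finite {b. a < b \<and> \<not> (\<exists>c. a < c \<and> c < b)}"
      using finite_upper_covers[of a] by (simp add: covers_def)
    show "finite {b. b < a \<and> \<not> (\<exists>c. b < c \<and> c < a)}"
      using finite_lower_covers[of a] by (simp add: covers_def)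
  qed
  let ?g = "\<lambda>a :: 'a. {B. block B \<and> a \<in> B} \<times> {a}"
  note bij = bij_betw_sum_carrier_dissection[OF M]
  have le: "sum_le dissection (?g a) (?g b) \<longleftrightarrow> a \<le> b" for a b
    using sum_le_dissection_imp_le[OF M] le_imp_sum_le_dissection[OF M] by blast
  \<comment> \<open>\<open>order_isomorphic\<close> asks for a map out of the sum, hence the inverse
    of \<open>?g\<close>.\<close>
  have "sum_le dissection X Y \<longleftrightarrow> inv ?g X \<le> inv ?g Y"
    if "X \<in> sum_carrier dissection" "Y \<in> sum_carrier dissection" for X Y
    using le[of "inv ?g X" "inv ?g Y"] that by (simp add: bij_betw_inv_into_right[OF bij])
  then show ?thesis
    unfolding order_isomorphic_def using bij_betw_inv_into[OF bij] by blast
qed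

end
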